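(* Let $A\subset\mathbb{R}$ be a finite set of SzT-type with parameter $\alpha=2$ (with corresponding constant $d(A)>0$), and let $m\ge 3$ be an integer. Then, for every real $\tau\ge 1$, $$\left|\left\{(a_1,\dots,a_m)\in A^m : \left|(A-a_1)\cap\dots\cap(A-a_m)\right|\ge\tau\right\}\right|\le\frac{d(A)\,|A|\,\mathsf{E}_{m-1,3}(A)}{\tau^3}.$$
   Context: For finite sets $X,Y\subset\mathbb{R}$ and $s\in\mathbb{R}$, $\delta_{X,Y}(s)$ denotes the number of representations $s=x-y$ with $x\in X$, $y\in Y$. A finite set $X\subset\mathbb{R}$ is of Szemerédi–Trotter type (SzT-type) with parameter $\alpha\ge 1$ if there is a parameter $d(X)>0$ such that $$\left|\{s\in X-Y : \delta_{X,Y}(s)\ge\tau\}\right|\le \frac{d(X)\,|X|\,|Y|^{\alpha}}{\tau^3}$$ for every finite set $Y\subset\mathbb{R}$ and every real $\tau\ge 1$. When a set $X$ is said to be of SzT-type, $d(X)$ denotes such a parameter. For a finite $A\subset\mathbb{R}$, an integer $k\ge 2$ and $\vec{x}=(x_1,\dots,x_{k-1})\in\mathbb{R}^{k-1}$, put $A_{\vec{x}}:=A\cap(A-x_1)\cap\dots\cap(A-x_{k-1})$, where $A-x=\{a-x : a\in A\}$. For integers $k,l\ge 2$ define $$\mathsf{E}_{k,l}(A):=\sum_{\vec{x}\in\mathbb{R}^{k-1}}|A_{\vec{x}}|^l$$ (only finitely many terms are nonzero). *)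

theory Defs
  imports "HOL-Analysis.Infinite_Sum"
begin

definition translate :: "real set \<Rightarrow> real \<Rightarrow> real set" where
  "translate A x = (\<lambda>a. a - x) ` A"

definition diff_set :: "real set \<Rightarrow> real set \<Rightarrow> real set" where
  "diff_set X Y = {x - y | x y. x \<in> X \<and> y \<in> Y}"

definition diff_reps :: "real set \<Rightarrow> real set \<Rightarrow> real \<Rightarrow> nat" where
  "diff_reps X Y s = card {(x, y). x \<in> X \<and> y \<in> Y \<and> s = x - y}"

text \<open>
  \<open>SzT_type \<alpha> d X\<close>: the finite set \<open>X\<close> is of Szemeredi-Trotter type with parameter \<open>\<alpha>\<close>,
  and \<open>d\<close> is an admissible value of \<open>d(X)\<close>.
\<close>

definition SzT_type :: "real \<Rightarrow> real \<Rightarrow> real set \<Rightarrow> bool" where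
  "SzT_type \<alpha> d X \<longleftrightarrow>
     finite X \<and> \<alpha> \<ge> 1 \<and> d > 0 \<and>
     (\<forall>Y \<tau>. finite Y \<longrightarrow> \<tau> \<ge> 1 \<longrightarrow>
        real (card {s \<in> diff_set X Y. real (diff_reps X Y s) \<ge> \<tau>})
          \<le> d * real (card X) * real (card Y) powr \<alpha> / \<tau> ^ 3)"

text \<open>
  A vector in \<open>\<real>\<^sup>n\<close> is a list of length \<open>n\<close>. The first factor \<open>A\<close> accounts for the
  component \<open>x\<^sub>0 = 0\<close>.
\<close>

definition multi_inter :: "real set \<Rightarrow> real list \<Rightarrow> real set" where
  "multi_inter A xs = A \<inter> (\<Inter>x\<in>set xs. translate A x)"

text \<open>
  Intended for finite \<open>A\<close> and \<open>k, l \<ge> 2\<close>. The sum over \<open>\<real>\<^sup>k\<^sup>-\<^sup>1\<close> is an unordered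
  infinite sum; it has finite support, see below.
\<close>

definition higher_energy :: "nat \<Rightarrow> nat \<Rightarrow> real set \<Rightarrow> real" where
  "higher_energy k l A =
     (\<Sum>\<^sub>\<infinity>xs\<in>{xs :: real list. length xs = k - 1}. real (card (multi_inter A xs)) ^ l)"

lemma finite_multi_inter_support:
  assumes "finite A"
  shows "finite {xs. length xs = n \<and> multi_inter A xs \<noteq> {}}"
proof (rule finite_subset)
  show "{xs. length xs = n \<and> multi_inter A xs \<noteq> {}}
          \<subseteq> {xs. set xs \<subseteq> (\<lambda>(a, b). a - b) ` (A \<times> A) \<and> length xs = n}"
    by (force simp: multi_inter_def translate_def image_iff)
  show "finite {xs. set xs \<subseteq> (\<lambda>(a, b). a - b) ` (A \<times> A) \<and> length xs = n}"
    using assms by (intro finite_lists_length_eq) auto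
qed

lemma higher_energy_eq_sum:
  assumes "finite A" "l > 0"
  shows "higher_energy k l A =
    (\<Sum>xs | length xs = k - 1 \<and> multi_inter A xs \<noteq> {}. real (card (multi_inter A xs)) ^ l)"
proof -
  have "higher_energy k l A =
    (\<Sum>\<^sub>\<infinity>xs\<in>{xs. length xs = k - 1 \<and> multi_inter A xs \<noteq> {}}. real (card (multi_inter A xs)) ^ l)"
    unfolding higher_energy_def using assms(2)
    by (intro infsum_cong_neutral) auto
  then show ?thesis
    using finite_multi_inter_support[OF assms(1)] by simp
qed

end

theory Submission
  imports Defs
begin

text \<open>
  Split a tuple as \<open>a\<close>, \<open>b\<close>, followed by \<open>b + x\<close> for the entries \<open>x\<close> of a vector \<open>xs\<close>, so that
  \<open>xs\<close> records the positions of the last entries relative to \<open>b\<close>. With \<open>Y = A\<^sub>x\<^sub>s\<close>, the entries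
  after \<open>a\<close> all lie in \<open>A\<close> exactly if \<open>b \<in> Y\<close>, and the translates by these entries intersect in
  \<open>Y - b\<close>. The whole intersection is thus \<open>(A - a) \<inter> (Y - b)\<close>, whose elements are the
  representations of \<open>a - b\<close> as a difference from \<open>A \<times> Y\<close> (\<open>card_translate_Int_translate\<close>).
  So for fixed \<open>xs\<close> one counts the pairs in \<open>A \<times> Y\<close> whose difference is popular, that is, has at
  least \<open>\<tau>\<close> representations. The Szemeredi--Trotter hypothesis bounds the number of popular
  differences by \<open>d |A| |Y|\<^sup>2 / \<tau>\<^sup>3\<close>, and each comes from at most \<open>|Y|\<close> pairs, which supplies the
  third factor \<open>|Y|\<close> (\<open>card_popular_pairs_le\<close>). Summing \<open>d |A| |A\<^sub>x\<^sub>s|\<^sup>3 / \<tau>\<^sup>3\<close> over \<open>xs\<close> gives the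
  energy of order three.
\<close>

lemma mem_translate_iff: "t \<in> translate A x \<longleftrightarrow> t + x \<in> A"
  unfolding translate_def image_iff by (metis add_diff_cancel_right' diff_add_cancel)

lemma finite_multi_inter: "finite A \<Longrightarrow> finite (multi_inter A xs)"
  by (simp add: multi_inter_def)

text \<open>A common element \<open>t\<close> corresponds to the representation \<open>(t + a) - (t + b)\<close>.\<close>

lemma card_translate_Int_translate:
  "card (translate X a \<inter> translate Y b) = diff_reps X Y (a - b)"
proof -
  have "bij_betw (\<lambda>t. (t + a, t + b)) (translate X a \<inter> translate Y b)
          {(x, y). x \<in> X \<and> y \<in> Y \<and> a - b = x - y}"
  proof (rule bij_betw_byWitness[where f' = "\<lambda>(x, y). x - a"])
    have "x - a + b \<in> Y" if "a - b = x - y" "y \<in> Y" for x y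
    proof -
      have "x - a + b = y"
        using that(1) by simp
      then show ?thesis
        using that(2) by simp
    qed
    then show "(\<lambda>(x, y). x - a) ` {(x, y). x \<in> X \<and> y \<in> Y \<and> a - b = x - y}
            \<subseteq> translate X a \<inter> translate Y b"
      by (auto simp: mem_translate_iff)
  qed (auto simp: mem_translate_iff)
  then show ?thesis
    unfolding diff_reps_def by (rule bij_betw_same_card)
qed

text \<open>
  Passing to differences relative to \<open>b\<close> turns an intersection of translates into a single
  translate, in accordance with the component \<open>x\<^sub>0 = 0\<close> of the vector.
\<close>

lemma INT_translate_eq_translate_multi_inter:
  "(\<Inter>a\<in>set (b # cs). translate A a) = translate (multi_inter A (map (\<lambda>c. c - b) cs)) b"
  by (auto simp: multi_inter_def mem_translate_iff)

text \<open>The second coordinate of a pair determines the first once the difference is given.\<close>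

lemma diff_reps_le_card:
  assumes "finite Y"
  shows "diff_reps X Y s \<le> card Y"
  unfolding diff_reps_def
  by (rule card_inj_on_le[where f = snd]) (use assms in \<open>auto simp: inj_on_def\<close>)

text \<open>
  Grouping the pairs by their difference costs one factor \<open>|Y|\<close> over the number of popular
  differences.
\<close>

lemma card_popular_pairs_le:
  assumes "SzT_type \<alpha> d X" "finite Y" "\<tau> \<ge> 1"
  shows "real (card {(x, y). x \<in> X \<and> y \<in> Y \<and> real (diff_reps X Y (x - y)) \<ge> \<tau>})
           \<le> d * real (card X) * real (card Y) powr \<alpha> * real (card Y) / \<tau> ^ 3"
proof -
  define L where "L = {s \<in> diff_set X Y. real (diff_reps X Y s) \<ge> \<tau>}"
  have "finite X"
    using assms(1) by (simp add: SzT_type_def)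
  then have "finite ((\<lambda>(x, y). x - y) ` (X \<times> Y))"
    using assms(2) by simp
  moreover have "L \<subseteq> (\<lambda>(x, y). x - y) ` (X \<times> Y)"
    by (auto simp: L_def diff_set_def)
  ultimately have "finite L"
    by (rule finite_subset[rotated])
  have "{(x, y). x \<in> X \<and> y \<in> Y \<and> real (diff_reps X Y (x - y)) \<ge> \<tau>}
          = (\<Union>s\<in>L. {(x, y). x \<in> X \<and> y \<in> Y \<and> s = x - y})"
    by (auto simp: L_def diff_set_def)
  then have "card {(x, y). x \<in> X \<and> y \<in> Y \<and> real (diff_reps X Y (x - y)) \<ge> \<tau>}
          \<le> (\<Sum>s\<in>L. diff_reps X Y s)"
    unfolding diff_reps_def using card_UN_le[OF \<open>finite L\<close>] by simp
  also have "\<dots> \<le> card L * card Y"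
    using sum_bounded_above[of L "diff_reps X Y" "card Y"] diff_reps_le_card[OF assms(2)] by simp
  finally have "real (card {(x, y). x \<in> X \<and> y \<in> Y \<and> real (diff_reps X Y (x - y)) \<ge> \<tau>})
          \<le> real (card L) * real (card Y)"
    unfolding of_nat_mult[symmetric] of_nat_le_iff .
  also have "\<dots> \<le> d * real (card X) * real (card Y) powr \<alpha> / \<tau> ^ 3 * real (card Y)"
  proof (rule mult_right_mono)
    show "real (card L) \<le> d * real (card X) * real (card Y) powr \<alpha> / \<tau> ^ 3"
      using assms unfolding SzT_type_def L_def by blast
  qed simp
  finally show ?thesis
    by simp
qed

theorem lemma9:
  fixes A :: "real set" and d \<tau> :: real and m :: nat
  assumes "SzT_type 2 d A"
    and "m \<ge> 3"
    and "\<tau> \<ge> 1"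
  shows "real (card {as :: real list. length as = m \<and> set as \<subseteq> A \<and>
             real (card (\<Inter>a\<in>set as. translate A a)) \<ge> \<tau>})
           \<le> d * real (card A) * higher_energy (m - 1) 3 A / \<tau> ^ 3"
proof -
  have fin: "finite A"
    using assms(1) by (simp add: SzT_type_def)
  define S where "S = {as :: real list. length as = m \<and> set as \<subseteq> A \<and>
             real (card (\<Inter>a\<in>set as. translate A a)) \<ge> \<tau>}"
  define P where "P = {xs. length xs = m - 1 - 1 \<and> multi_inter A xs \<noteq> {}}"
  define F where "F xs = {(a, b). a \<in> A \<and> b \<in> multi_inter A xs \<and>
             real (diff_reps A (multi_inter A xs) (a - b)) \<ge> \<tau>}" for xs
  have "finite P"
    unfolding P_def by (rule finite_multi_inter_support[OF fin])
  have finF: "finite (F xs)" for xs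
    by (rule finite_subset[of _ "A \<times> multi_inter A xs"])
       (use fin in \<open>auto simp: F_def finite_multi_inter\<close>)
  have "S \<subseteq> (\<lambda>(xs, a, b). a # b # map (\<lambda>x. x + b) xs) ` Sigma P F"
  proof
    fix as assume as: "as \<in> S"
    then obtain a b cs where as_eq: "as = a # b # cs"
      using \<open>m \<ge> 3\<close> by (cases as; cases "tl as") (auto simp: S_def)
    define xs where "xs = map (\<lambda>c. c - b) cs"
    have mem: "a \<in> A" "b \<in> multi_inter A xs"
      using as by (auto simp: S_def as_eq xs_def multi_inter_def mem_translate_iff)
    have "(\<Inter>a\<in>set as. translate A a) = translate A a \<inter> translate (multi_inter A xs) b"
      unfolding as_eq xs_def INT_translate_eq_translate_multi_inter[symmetric] by simp
    then have "(a, b) \<in> F xs"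
      using as mem by (simp add: S_def F_def card_translate_Int_translate)
    moreover have "xs \<in> P"
      using as mem by (auto simp: S_def P_def as_eq xs_def)
    moreover have "as = a # b # map (\<lambda>x. x + b) xs"
      by (simp add: as_eq xs_def o_def)
    ultimately show "as \<in> (\<lambda>(xs, a, b). a # b # map (\<lambda>x. x + b) xs) ` Sigma P F"
      by (auto intro!: rev_image_eqI[where x = "(xs, a, b)"])
  qed
  then have "card S \<le> card (Sigma P F)"
    using \<open>finite P\<close> finF by (intro surj_card_le) auto
  also have "\<dots> = (\<Sum>xs\<in>P. card (F xs))"
    using \<open>finite P\<close> finF by simp
  finally have "real (card S) \<le> (\<Sum>xs\<in>P. real (card (F xs)))"
    unfolding of_nat_sum[symmetric] of_nat_le_iff .
  also have "\<dots> \<le> (\<Sum>xs\<in>P. d * real (card A) * real (card (multi_inter A xs)) ^ 3 / \<tau> ^ 3)"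
  proof (rule sum_mono)
    fix xs
    show "real (card (F xs)) \<le> d * real (card A) * real (card (multi_inter A xs)) ^ 3 / \<tau> ^ 3"
      using card_popular_pairs_le[OF assms(1) finite_multi_inter[OF fin, of xs] assms(3)]
      by (simp add: F_def power3_eq_cube power2_eq_square mult.assoc)
  qed
  also have "\<dots> = d * real (card A) * higher_energy (m - 1) 3 A / \<tau> ^ 3"
    using fin by (simp add: higher_energy_eq_sum P_def sum_distrib_left sum_divide_distrib)
  finally show ?thesis
    unfolding S_def .
qed

end
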